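(* There exists $N_0$ such that for all integers $N\geq N_0$, the number of integers $n$ with $0\leq n<N$ satisfying $d_n\leq \frac{\log N}{100}$ is at most $N^{0.183}$.
   Context: Here $\log$ is the natural logarithm. Every nonnegative integer $n$ has a unique binary expansion $n=\sum_{i=0}^{\nu}\varepsilon_i(n)2^i$ with $\varepsilon_i(n)\in\{0,1\}$ and ($\nu=0$ or $\varepsilon_\nu(n)\neq 0$). The Van der Corput sequence in base $2$ is $\omega=(\omega_n)_{n\geq 0}$ with $\omega_n=\sum_{i=0}^{\nu}\varepsilon_i(n)2^{-i-1}$. For a sequence $x=(x_n)_{n\geq 0}$ in $[0,1)$ and an integer $N\geq 1$, the discrepancy is $D_N(x)=\sup_{0\leq a\leq b\leq 1}\left|\frac{A_N(x,a,b)}{N}-(b-a)\right|$, where $A_N(x,a,b)=|\{0\leq n<N: a\leq x_n<b\}|$; moreover $D_0(x)=0$. Set $d_N=N D_N(\omega)$ for $N\geq 0$. *)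

theory Defs
  imports "HOL-Analysis.Analysis" "HOL-Library.Discrete_Functions"
begin

definition binary_digit :: "nat \<Rightarrow> nat \<Rightarrow> nat"
  where "binary_digit n i = n div 2 ^ i mod 2"

text \<open>The top index of the binary expansion of \<open>n\<close> is \<open>floor_log n\<close>, where
  \<open>floor_log 0 = 0\<close>. The next two lemmas confirm that this is the expansion
  with \<open>\<nu> = 0\<close> or \<open>\<epsilon>\<^sub>\<nu>(n) \<noteq> 0\<close>.\<close>

lemma binary_expansion: "n = (\<Sum>i\<le>floor_log n. binary_digit n i * 2 ^ i)"
proof -
  have *: "n mod 2 ^ k = (\<Sum>i<k. binary_digit n i * 2 ^ i)" for k
  proof (induction k)
    case (Suc k)
    have "n mod 2 ^ Suc k = 2 ^ k * (n div 2 ^ k mod 2) + n mod 2 ^ k"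
      using mod_mult2_eq[of n "2 ^ k" 2] by (simp add: mult.commute)
    with Suc show ?case by (simp add: binary_digit_def mult.commute)
  qed simp
  have "n < 2 ^ Suc (floor_log n)"
    using floor_log_exp2_gt[of n] by simp
  then show ?thesis
    using *[of "Suc (floor_log n)"] by (simp add: lessThan_Suc_atMost)
qed

lemma binary_digit_top: "floor_log n = 0 \<or> binary_digit n (floor_log n) \<noteq> 0"
proof (cases "n = 0")
  case False
  have "2 ^ floor_log n \<le> n" "n < 2 * 2 ^ floor_log n"
    using False floor_log_exp2_le[of n] floor_log_exp2_gt[of n] by auto
  then have "n div 2 ^ floor_log n = 1"
    by (intro div_nat_eqI) auto
  then show ?thesis by (simp add: binary_digit_def)
qed simp

definition van_der_Corput :: "nat \<Rightarrow> real"
  where "van_der_Corput n = (\<Sum>i\<le>floor_log n. real (binary_digit n i) / 2 ^ (i + 1))"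

definition counting :: "(nat \<Rightarrow> real) \<Rightarrow> nat \<Rightarrow> real \<Rightarrow> real \<Rightarrow> nat"
  where "counting x N a b = card {n. n < N \<and> a \<le> x n \<and> x n < b}"

definition discrepancy :: "(nat \<Rightarrow> real) \<Rightarrow> nat \<Rightarrow> real"
  where "discrepancy x N =
    (if N = 0 then 0
     else (SUP (a, b) \<in> {(a, b). 0 \<le> a \<and> a \<le> b \<and> b \<le> 1}.
             \<bar>real (counting x N a b) / real N - (b - a)\<bar>))"

text \<open>On \<^typ>\<open>real\<close> the supremum is meaningful only for bounded sets.\<close>

lemma discrepancy_bdd_above:
  "bdd_above ((\<lambda>(a, b). \<bar>real (counting x N a b) / real N - (b - a)\<bar>)
     ` {(a, b). 0 \<le> a \<and> a \<le> b \<and> b \<le> 1})"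
proof -
  have "counting x N a b \<le> N" for a b
    using card_mono[of "{..<N}" "{n. n < N \<and> a \<le> x n \<and> x n < b}"]
    by (auto simp: counting_def)
  then have "real (counting x N a b) / real N \<le> 1" for a b
    by (cases "N = 0") (auto simp: divide_le_eq_1)
  moreover have "0 \<le> real (counting x N a b) / real N" for a b
    by simp
  ultimately have "\<bar>real (counting x N a b) / real N - (b - a)\<bar> \<le> 1"
    if "0 \<le> a" "a \<le> b" "b \<le> 1" for a b
    using that by (smt (verit))
  then show ?thesis
    by (intro bdd_aboveI[where M = 1]) auto
qed

definition vdc_d :: "nat \<Rightarrow> real"
  where "vdc_d N = real N * discrepancy van_der_Corput N"

end

theory Submission
  imports Defs
begin

text \<open>Let \<open>r(n)\<close> be the number of blocks of ones in the binary expansion of \<open>n\<close>. Read the digits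
  of \<open>n\<close> from the lowest one upwards, move the top one of every block to the zero that follows it,
  and take the result as the digits of \<open>b\<close> after the binary point. Each block then contributes at
  least \<open>1 / 2\<close> to the counting error of \<open>[0, b)\<close>, so this error is at least \<open>r(n) / 2\<close>.
  Hence \<open>d\<^sub>n \<le> ln N / 100\<close>
  forces \<open>r(n) \<le> ln N / 50\<close>. The \<open>n < 2 ^ L\<close> with few blocks are counted by Chernoff's method:
  \<open>\<Sum>n<2 ^ L. z ^ (2 r(n)) \<le> (1 + z) ^ L\<close>, and \<open>z = 1 / 35\<close> is close enough to the optimum for the
  exponent \<open>0.183\<close>.\<close>

section \<open>The Van der Corput sequence under doubling of the index\<close>

lemma binary_digit_double [simp]:
  "binary_digit (2 * n) 0 = 0" "binary_digit (2 * n) (Suc i) = binary_digit n i"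
  "binary_digit (Suc (2 * n)) 0 = 1" "binary_digit (Suc (2 * n)) (Suc i) = binary_digit n i"
  by (simp_all add: binary_digit_def div_mult2_eq)

text \<open>Appending a lowest digit shifts the expansion after the binary point one place to the
  right. The case \<open>n = 0\<close> is separate because \<open>floor_log\<close> stays
  \<open>0\<close> there.\<close>

lemma van_der_Corput_double: "van_der_Corput (2 * n) = van_der_Corput n / 2"
proof (cases "n = 0")
  case False
  then have "floor_log (2 * n) = Suc (floor_log n)"
    by simp
  then show ?thesis
    by (simp add: van_der_Corput_def sum.atMost_Suc_shift sum_divide_distrib
        del: sum.atMost_Suc)
qed (simp add: van_der_Corput_def binary_digit_def)

lemma van_der_Corput_Suc_double: "van_der_Corput (Suc (2 * n)) = (1 + van_der_Corput n) / 2"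
proof (cases "n = 0")
  case False
  then have "floor_log (Suc (2 * n)) = Suc (floor_log n)"
    by (subst floor_log_rec) auto
  then show ?thesis
    by (simp add: van_der_Corput_def sum.atMost_Suc_shift sum_divide_distrib
        add_divide_distrib del: sum.atMost_Suc)
qed (simp add: van_der_Corput_def binary_digit_def)

lemma van_der_Corput_0 [simp]: "van_der_Corput 0 = 0"
  by (simp add: van_der_Corput_def binary_digit_def)

lemma van_der_Corput_bounds: "0 \<le> van_der_Corput n \<and> van_der_Corput n < 1"
proof (induction n rule: less_induct)
  case (less n)
  show ?case
  proof (cases "n = 0")
    case False
    then have IH: "0 \<le> van_der_Corput (n div 2)" "van_der_Corput (n div 2) < 1"
      using less.IH[of "n div 2"] by auto
    consider "n = 2 * (n div 2)" | "n = Suc (2 * (n div 2))"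
      by linarith
    then show ?thesis
      using IH van_der_Corput_double[of "n div 2"] van_der_Corput_Suc_double[of "n div 2"]
      by cases auto
  qed simp
qed

section \<open>Counting errors of initial intervals and blocks of ones\<close>

lemma counting_van_der_Corput_0:
  "counting van_der_Corput N 0 b = card {n. n < N \<and> van_der_Corput n < b}"
  by (simp add: counting_def van_der_Corput_bounds)

text \<open>Odd indices give points in [1/2, 1), outside the interval, and an even index
  \<open>2 * m\<close> is below \<open>N\<close> exactly when
  \<open>m < Suc N div 2\<close>.\<close>

lemma counting_half:
  assumes "b \<le> 1"
  shows "counting van_der_Corput N 0 (b / 2) = counting van_der_Corput (Suc N div 2) 0 b"
proof -
  have "{n. n < N \<and> van_der_Corput n < b / 2} =
      (\<lambda>n. 2 * n) ` {n. n < Suc N div 2 \<and> van_der_Corput n < b}" (is "?A = _ ` ?B")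
  proof (rule set_eqI)
    fix n
    consider m where "n = 2 * m" | m where "n = Suc (2 * m)"
      by (metis evenE oddE Suc_eq_plus1)
    then show "n \<in> ?A \<longleftrightarrow> n \<in> (\<lambda>n. 2 * n) ` ?B"
    proof cases
      case 1
      then show ?thesis
        by (auto simp: van_der_Corput_double image_iff)
    next
      case 2
      then show ?thesis
        using assms van_der_Corput_bounds[of m]
        by (auto simp: van_der_Corput_Suc_double image_iff) presburger
    qed
  qed
  then show ?thesis
    by (simp add: counting_van_der_Corput_0 card_image inj_on_def)
qed

text \<open>All \<open>Suc N\<close> even indices give points below 1/2 and are counted; halving the
  odd indices leads back to the interval up to \<open>b\<close>.\<close>

lemma counting_upper_half:
  assumes "0 \<le> b"
  shows "counting van_der_Corput (Suc (2 * N)) 0 ((1 + b) / 2) =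
    Suc N + counting van_der_Corput N 0 b"
proof -
  have "{n. n < Suc (2 * N) \<and> van_der_Corput n < (1 + b) / 2} =
      (\<lambda>n. 2 * n) ` {..N} \<union> (\<lambda>n. Suc (2 * n)) ` {n. n < N \<and> van_der_Corput n < b}"
    (is "?A = ?B \<union> ?C")
  proof (rule set_eqI)
    fix n
    consider m where "n = 2 * m" | m where "n = Suc (2 * m)"
      by (metis evenE oddE Suc_eq_plus1)
    then show "n \<in> ?A \<longleftrightarrow> n \<in> ?B \<union> ?C"
    proof cases
      case 1
      then show ?thesis
        using assms van_der_Corput_bounds[of m]
        by (auto simp: van_der_Corput_double image_iff)
    next
      case 2
      then show ?thesis
        by (auto simp: van_der_Corput_Suc_double image_iff) presburger
    qed
  qed
  moreover have "card ?B = Suc N" "card ?C = counting van_der_Corput N 0 b"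
    by (simp_all add: card_image inj_on_def counting_van_der_Corput_0)
  moreover have "?B \<inter> ?C = {}"
    by auto presburger
  ultimately show ?thesis
    by (simp add: counting_van_der_Corput_0 card_Un_disjoint)
qed

text \<open>Each block is counted at its top digit: \<open>n mod 4 = 1\<close> says that the lowest
  digit is a one followed by a zero.\<close>

fun one_blocks :: "nat \<Rightarrow> nat"
  where "one_blocks n =
    (if n = 0 then 0 else one_blocks (n div 2) + (if n mod 4 = 1 then 1 else 0))"

declare one_blocks.simps [simp del]

lemma one_blocks_0 [simp]: "one_blocks 0 = 0"
  by (simp add: one_blocks.simps)

lemma one_blocks_double: "one_blocks (2 * n) = one_blocks n"
proof (cases "n = 0")
  case False
  have "2 * n mod 4 \<noteq> 1"
    by presburger
  then show ?thesis
    using False by (subst one_blocks.simps) simp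
qed simp

lemma one_blocks_Suc_double:
  "one_blocks (Suc (2 * n)) = one_blocks n + (if even n then 1 else 0)"
proof -
  have "Suc (2 * n) mod 4 = 1 \<longleftrightarrow> even n"
    by presburger
  then show ?thesis
    by (subst one_blocks.simps) simp
qed

lemma ex_interval_counting_error:
  "\<exists>b. 0 \<le> b \<and> b \<le> 1 \<and>
    real (one_blocks n) / 2 \<le> real (counting van_der_Corput n 0 b) - real n * b"
proof (induction n rule: less_induct)
  case (less n)
  \<comment> \<open>In the three recursive cases \<open>b\<close> becomes \<open>b / 2\<close>,
    \<open>(1 + b) / 4\<close> and \<open>(1 + b) / 2\<close>. The error then grows by 0, by
    \<open>(3 - b) / 4\<close> and by \<open>(1 - b) / 2\<close>. As \<open>b \<le> 1\<close>, the
    second gain, made where a block ends, is at least 1/2, and the third is nonnegative.\<close>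
  consider "n = 0" | k where "n = 2 * k" "k \<noteq> 0"
    | m where "n = Suc (2 * (2 * m))" | k where "n = Suc (2 * k)" "odd k"
    by (metis evenE oddE Suc_eq_plus1 mult_0_right)
  then show ?case
  proof cases
    case 1
    then show ?thesis
      by (intro exI[of _ 0]) simp
  next
    case 2
    then obtain b where "0 \<le> b" "b \<le> 1"
      "real (one_blocks k) / 2 \<le> real (counting van_der_Corput k 0 b) - real k * b"
      using less.IH[of k] by auto
    then show ?thesis
      using 2 by (intro exI[of _ "b / 2"]) (simp add: counting_half one_blocks_double)
  next
    case 3
    then obtain b where b: "0 \<le> b" "b \<le> 1"
      "real (one_blocks m) / 2 \<le> real (counting van_der_Corput m 0 b) - real m * b"
      using less.IH[of m] by auto
    have "counting van_der_Corput n 0 ((1 + b) / 2 / 2) =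
        counting van_der_Corput (Suc (2 * m)) 0 ((1 + b) / 2)"
      using b 3 by (subst counting_half) auto
    also have "\<dots> = Suc m + counting van_der_Corput m 0 b"
      using b by (simp add: counting_upper_half)
    finally have "counting van_der_Corput n 0 ((1 + b) / 2 / 2) =
        Suc m + counting van_der_Corput m 0 b" .
    moreover have "one_blocks n = Suc (one_blocks m)"
      unfolding 3 one_blocks_Suc_double one_blocks_double by simp
    ultimately show ?thesis
      using b 3 by (intro exI[of _ "(1 + b) / 2 / 2"]) (auto simp: field_simps)
  next
    case 4
    then obtain b where "0 \<le> b" "b \<le> 1"
      "real (one_blocks k) / 2 \<le> real (counting van_der_Corput k 0 b) - real k * b"
      using less.IH[of k] by auto
    moreover from this have "counting van_der_Corput n 0 ((1 + b) / 2) =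
        Suc k + counting van_der_Corput k 0 b"
      using 4 by (simp add: counting_upper_half)
    moreover have "one_blocks n = one_blocks k"
      using 4 by (simp add: one_blocks_Suc_double)
    ultimately show ?thesis
      using 4 by (intro exI[of _ "(1 + b) / 2"]) (auto simp: field_simps)
  qed
qed

lemma one_blocks_le_vdc_d: "real (one_blocks n) / 2 \<le> vdc_d n"
proof (cases "n = 0")
  case False
  obtain b where b: "0 \<le> b" "b \<le> 1"
    "real (one_blocks n) / 2 \<le> real (counting van_der_Corput n 0 b) - real n * b"
    using ex_interval_counting_error by blast
  \<comment> \<open>A single interval with left endpoint 0 bounds the supremum from below.\<close>
  let ?e = "\<lambda>(a, b). \<bar>real (counting van_der_Corput n a b) / real n - (b - a)\<bar>"
  have "?e (0, b) \<le> discrepancy van_der_Corput n"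
    unfolding discrepancy_def using False b(1,2)
    by (simp only: if_False) (rule cSUP_upper[OF _ discrepancy_bdd_above], simp)
  then have "real n * (real (counting van_der_Corput n 0 b) / real n - b) \<le> vdc_d n"
    unfolding vdc_d_def by (intro mult_left_mono) auto
  moreover have "real n * (real (counting van_der_Corput n 0 b) / real n - b) =
      real (counting van_der_Corput n 0 b) - real n * b"
    using False by (simp add: right_diff_distrib)
  ultimately show ?thesis
    using b(3) by linarith
qed (simp add: vdc_d_def)

section \<open>Counting integers with few blocks of ones\<close>

lemma sum_lessThan_double:
  fixes f :: "nat \<Rightarrow> 'a::comm_monoid_add"
  shows "sum f {..<2 * n} = (\<Sum>k<n. f (2 * k)) + (\<Sum>k<n. f (Suc (2 * k)))"
  by (induction n) (simp_all add: algebra_simps)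

text \<open>Splitting by parity takes the pair (G, H) of sums to (G + H, \<open>z\<^sup>2\<close> G
  + H). This nonnegative linear map has eigenvector (1, z) with eigenvalue 1 + z, so a bound by
  multiples of (1, z) propagates. The second sum is there to close the induction.\<close>

lemma sum_power_one_blocks:
  fixes z :: real
  assumes "0 \<le> z" "z \<le> 1"
  shows "(\<Sum>n<2 ^ L. (z\<^sup>2) ^ one_blocks n) \<le> (1 + z) ^ L \<and>
    (\<Sum>n<2 ^ L. (z\<^sup>2) ^ one_blocks (Suc (2 * n))) \<le> z * (1 + z) ^ L"
proof (induction L)
  case 0
  then show ?case
    using assms one_blocks_Suc_double[of 0] by (simp add: power2_eq_square mult_left_le)
next
  case (Suc L)
  let ?G = "\<Sum>n<2 ^ L. (z\<^sup>2) ^ one_blocks n"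
  let ?H = "\<Sum>n<2 ^ L. (z\<^sup>2) ^ one_blocks (Suc (2 * n))"
  have "(\<Sum>n<2 ^ Suc L. (z\<^sup>2) ^ one_blocks n) = ?G + ?H"
    by (simp add: sum_lessThan_double one_blocks_double)
  moreover have "(\<Sum>n<2 ^ Suc L. (z\<^sup>2) ^ one_blocks (Suc (2 * n))) = z\<^sup>2 * ?G + ?H"
    using one_blocks_Suc_double[of "2 * _"] one_blocks_Suc_double[of "Suc (2 * _)"]
    by (simp add: sum_lessThan_double one_blocks_double sum_distrib_left)
  moreover have "z\<^sup>2 * ?G \<le> z\<^sup>2 * (1 + z) ^ L"
    using Suc by (intro mult_left_mono) auto
  ultimately show ?case
    using Suc by (auto simp: algebra_simps power2_eq_square)
qed

text \<open>Since \<open>z \<le> 1\<close>, every counted \<open>n\<close> has weight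
  \<open>z powr (2 * one_blocks n - 2 * t)\<close> at least 1; summing the weights over all
  \<open>n < 2 ^ L\<close> only adds nonnegative terms.\<close>

lemma card_one_blocks_le:
  fixes z t :: real
  assumes "0 < z" "z \<le> 1" and "N \<le> 2 ^ L"
  shows "real (card {n. n < N \<and> real (one_blocks n) \<le> t}) \<le> z powr (- 2 * t) * (1 + z) ^ L"
proof -
  let ?S = "{n. n < N \<and> real (one_blocks n) \<le> t}"
  have "1 \<le> z powr (- 2 * t) * (z\<^sup>2) ^ one_blocks n" if "n \<in> ?S" for n
  proof -
    have "1 \<le> z powr (2 * real (one_blocks n) - 2 * t)"
      using that assms powr_mono'[of "2 * real (one_blocks n) - 2 * t" 0 z] by simp
    also have "\<dots> = z powr (- 2 * t) * z powr real (2 * one_blocks n)"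
      by (simp flip: powr_add add: algebra_simps)
    also have "z powr real (2 * one_blocks n) = (z\<^sup>2) ^ one_blocks n"
      using assms by (subst powr_realpow) (simp_all add: power_mult)
    finally show ?thesis .
  qed
  then have "real (card ?S) \<le> (\<Sum>n\<in>?S. z powr (- 2 * t) * (z\<^sup>2) ^ one_blocks n)"
    using sum_mono[of ?S "\<lambda>_. 1 :: real"] by simp
  also have "\<dots> \<le> (\<Sum>n<2 ^ L. z powr (- 2 * t) * (z\<^sup>2) ^ one_blocks n)"
    using assms by (intro sum_mono2) auto
  also have "\<dots> = z powr (- 2 * t) * (\<Sum>n<2 ^ L. (z\<^sup>2) ^ one_blocks n)"
    by (simp add: sum_distrib_left)
  also have "\<dots> \<le> z powr (- 2 * t) * (1 + z) ^ L"
    using assms sum_power_one_blocks[of z L] by (intro mult_left_mono) auto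
  finally show ?thesis .
qed

text \<open>The left side is the exponent for z = 1/35; the exact minimiser is ln 2 / (25 - ln 2),
  about 1/35.07. The margin is small, so 77/15 and 5/123 serve as close upper bounds for the base 2
  logarithms of 35 and 36/35.\<close>

lemma chernoff_exponent: "ln 35 / 25 + ln (36 / 35) / ln 2 < (0.183 :: real)"
proof -
  have "ln ((35::real) ^ 15) \<le> ln (2 ^ 77)"
    by (subst ln_le_cancel_iff) auto
  then have "15 * ln 35 \<le> 77 * ln (2::real)"
    using ln_realpow[of "35::real" 15] ln_realpow[of "2::real" 77] by linarith
  moreover have "ln ((36 / 35 :: real) ^ 123) \<le> ln (2 ^ 5)"
    by (subst ln_le_cancel_iff) (auto simp: power_divide)
  then have "123 * ln (36 / 35) \<le> 5 * ln (2::real)"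
    using ln_realpow[of "36 / 35 :: real" 123] ln_realpow[of "2::real" 5] by linarith
  then have "ln (36 / 35) / ln 2 \<le> (5 / 123 :: real)"
    by (simp add: divide_le_eq)
  moreover have "ln 2 < (0.69316::real)"
    using ln_approx_bounds[of 2 3] by (simp add: eval_nat_numeral)
  ultimately show ?thesis
    by simp
qed

theorem theorem2p1:
  shows "\<exists>N\<^sub>0::nat. \<forall>N::nat. N \<ge> N\<^sub>0 \<longrightarrow>
    real (card {n::nat. n < N \<and> vdc_d n \<le> ln (real N) / 100}) \<le> real N powr 0.183"
proof -
  define c where "c = ln 35 / 25 + ln (36 / 35) / ln (2::real)"
  have bound: "real (card {n. n < N \<and> vdc_d n \<le> ln (real N) / 100}) \<le> 36 / 35 * real N powr c"
    if "0 < N" for N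
  proof -
    \<comment> \<open>The successor is needed for \<open>N < 2 ^ L\<close>; it costs the constant
      factor 36/35 in the bound.\<close>
    define L where "L = Suc (floor_log N)"
    have "N < 2 ^ L"
      using floor_log_exp2_gt[of N] by (simp add: L_def)
    have "2 ^ floor_log N \<le> real N"
      using that floor_log_exp2_le[of N] by (metis of_nat_le_iff of_nat_numeral of_nat_power)
    then have "floor_log N * ln 2 \<le> ln (real N)"
      by (subst ln_realpow[symmetric]) (auto simp: that)
    then have "real (floor_log N) \<le> ln (real N) / ln 2"
      by (simp add: field_simps)
    then have "(36 / 35 :: real) powr real (floor_log N) \<le> (36 / 35) powr (ln (real N) / ln 2)"
      by (intro powr_mono) auto
    \<comment> \<open>Base and exponent trade places: x powr (ln y) and y powr (ln x) are both exp
      (ln x * ln y).\<close>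
    also have "\<dots> = real N powr (ln (36 / 35) / ln 2)"
      using that by (simp add: powr_def)
    finally have power_L: "(36 / 35 :: real) ^ L \<le> 36 / 35 * real N powr (ln (36 / 35) / ln 2)"
      by (simp add: L_def powr_realpow)
    have "{n. n < N \<and> vdc_d n \<le> ln (real N) / 100} \<subseteq>
        {n. n < N \<and> real (one_blocks n) \<le> ln (real N) / 50}"
    proof clarify
      fix n
      assume "vdc_d n \<le> ln (real N) / 100"
      then show "real (one_blocks n) \<le> ln (real N) / 50"
        using one_blocks_le_vdc_d[of n] by linarith
    qed
    then have "card {n. n < N \<and> vdc_d n \<le> ln (real N) / 100} \<le>
        card {n. n < N \<and> real (one_blocks n) \<le> ln (real N) / 50}"
      by (intro card_mono) auto
    also have "real \<dots> \<le> (1 / 35) powr (- 2 * (ln (real N) / 50)) * (1 + 1 / 35) ^ L"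
      using \<open>N < 2 ^ L\<close> by (intro card_one_blocks_le) auto
    also have "(1 / 35) powr (- 2 * (ln (real N) / 50)) = real N powr (ln 35 / 25)"
      using that by (simp add: powr_def ln_div)
    also have "real N powr (ln 35 / 25) * (1 + 1 / 35) ^ L \<le>
        real N powr (ln 35 / 25) * (36 / 35 * real N powr (ln (36 / 35) / ln 2))"
      using power_L by (intro mult_left_mono) simp_all
    also have "\<dots> = 36 / 35 * real N powr c"
      by (simp add: c_def powr_add)
    finally show ?thesis
      by simp
  qed
  \<comment> \<open>The strict inequality leaves a positive power of \<open>N\<close>, which
    eventually absorbs the factor 36/35.\<close>
  have "0 < 0.183 - c"
    using chernoff_exponent by (simp add: c_def)
  then have "filterlim (\<lambda>N. real N powr (0.183 - c)) at_top sequentially"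
    by (intro filterlim_compose[OF real_powr_at_top] filterlim_real_sequentially)
  then have "eventually (\<lambda>N. 36 / 35 \<le> real N powr (0.183 - c)) sequentially"
    unfolding filterlim_at_top by blast
  then have "eventually (\<lambda>N. real (card {n. n < N \<and> vdc_d n \<le> ln (real N) / 100})
      \<le> real N powr 0.183) sequentially"
    using eventually_gt_at_top[of 0]
  proof eventually_elim
    case (elim N)
    have "real (card {n. n < N \<and> vdc_d n \<le> ln (real N) / 100}) \<le> 36 / 35 * real N powr c"
      using elim by (intro bound)
    also have "\<dots> \<le> real N powr (0.183 - c) * real N powr c"
      using elim by (intro mult_right_mono) auto
    also have "\<dots> = real N powr 0.183"
      by (simp flip: powr_add)
    finally show ?case .
  qed
  then show ?thesis
    by (simp add: eventually_sequentially)
qed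

end
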